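(* Let $p=1$ and suppose there is no boundary penalty ($\beta=0$). Assume that $K1=0$. Let $f^*\in BV(\Omega)$ and let $Df^*=\boldsymbol{\nu}^*|Df^*|$ be the polar decomposition of its BV-derivative. Assume that for every $z\in\partial\Omega$ at least one of the following two conditions holds: $$\operatorname{sgn}\bigl\{(K[\nabla G(\cdot;y)\cdot\boldsymbol{\nu}^*(y)])(z)\bigr\}\ge 0\quad\text{for all } y\in\Omega,$$ or $$\operatorname{sgn}\bigl\{(K[\nabla G(\cdot;y)\cdot\boldsymbol{\nu}^*(y)])(z)\bigr\}\le 0\quad\text{for all } y\in\Omega.$$ Then $f^*$ solves the basis pursuit problem $$f^*\in\operatorname*{arg\,min}_{g\in BV(\Omega)}\operatorname{TV}_{\widetilde w}(g)\quad\text{subject to}\quad Kg=Kf^*,$$ where $\operatorname{TV}_{\widetilde w}(g)=\int_\Omega\bigl\|K(\nabla G(\cdot;y)\cdot\boldsymbol{\nu}_g(y))\bigr\|_{L^1(\partial\Omega)}\,d|Dg|(y)$.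
   Context: $\Omega\subset\mathbb{R}^2$ is a bounded Lipschitz domain and $K:L^2(\Omega)\to L^2(\partial\Omega)$ is a linear operator; $1$ denotes the constant function. For $g\in BV(\Omega)$, $Dg$ is the vector-valued Radon measure derivative with total variation measure $|Dg|$ and polar decomposition $Dg=\boldsymbol{\nu}_g|Dg|$, $|\boldsymbol{\nu}_g|_2=1$ $|Dg|$-a.e.; a Borel representative of $\boldsymbol{\nu}_g$ is fixed (at points where the polar decomposition does not determine a direction it may be set to $0$). $\boldsymbol{\nu}^*=\boldsymbol{\nu}_{f^*}$. $G$ is the Neumann Green's function (symmetric, unique up to an additive constant): $-\Delta_yG(y;x)=\delta_x(y)-\frac1{|\Omega|}$ for $y\in\Omega$, $\nabla_yG(y;x)\cdot\boldsymbol{n}(y)=0$ for $y\in\partial\Omega$. The notation $\nabla G(\cdot;y)$ means the gradient of $G(x;y)$ with respect to $y$, regarded as a function of the first variable $x$, so that for $f\in BV(\Omega)$ $$f(x)=\int_\Omega\nabla G(x;y)\cdot\boldsymbol{\nu}_f(y)\,d|Df|(y)+\frac1{|\Omega|}\int_\Omega f(y)\,dy.$$ $K$ acts on the variable $x$. Standing convention: for $y\in\Omega$ and $\boldsymbol{d}\in\mathbb{R}^2$ the function $K(\nabla G(\cdot;y)\cdot\boldsymbol{d})$ on $\partial\Omega$ is well defined with pointwise values, is linear in $\boldsymbol{d}$, belongs to $L^1(\partial\Omega)$ and is jointly measurable in $(z,y)\in\partial\Omega\times\Omega$; and $K$ may be interchanged with the integral in the representation formula, i.e. (since $K1=0$)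 for every $f\in BV(\Omega)$, $$(Kf)(z)=\int_\Omega\bigl(K(\nabla G(\cdot;y)\cdot\boldsymbol{\nu}_f(y))\bigr)(z)\,d|Df|(y)\quad\text{for a.e. } z\in\partial\Omega.$$ *)

theory Defs
  imports "HOL-Analysis.Analysis"
begin

subsection \<open>Domains and boundary measure\<close>

text \<open>
  Near each boundary point \<open>p\<close>, after a rigid motion, the set is the region strictly above the
  graph of a Lipschitz function.
\<close>
definition lipschitz_domain :: "(real^2) set \<Rightarrow> bool" where
  "lipschitz_domain \<Omega> \<longleftrightarrow> open \<Omega> \<and> connected \<Omega> \<and> \<Omega> \<noteq> {} \<and>
     (\<forall>p\<in>frontier \<Omega>. \<exists>(T :: real^2 \<Rightarrow> real^2) (\<gamma> :: real \<Rightarrow> real) L r h.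
        orthogonal_transformation T \<and> L-lipschitz_on UNIV \<gamma> \<and> 0 < r \<and> 0 < h \<and>
        (\<forall>x. \<bar>T (x - p) $ 1\<bar> < r \<and> \<bar>T (x - p) $ 2\<bar> < h \<longrightarrow>
              (x \<in> \<Omega> \<longleftrightarrow> \<gamma> (T (x - p) $ 1) < T (x - p) $ 2)))"

definition hausdorff_content :: "real \<Rightarrow> 'a::metric_space set \<Rightarrow> ennreal" where
  "hausdorff_content \<delta> A =
     (INF C\<in>{C :: nat \<Rightarrow> 'a set. A \<subseteq> (\<Union>i. C i) \<and> (\<forall>i. bounded (C i) \<and> diameter (C i) \<le> \<delta>)}.
        \<Sum>i. ennreal (diameter (C i)))"

text \<open>
  One-dimensional Hausdorff measure, with the normalisation in which a segment has its length.
  Its outer measure is a metric outer measure, hence countably additive on the Borel sets.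
\<close>
definition hausdorff_measure_1 :: "'a::metric_space measure" where
  "hausdorff_measure_1 =
     measure_of UNIV (sets borel) (\<lambda>A. SUP \<delta>\<in>{0<..}. hausdorff_content \<delta> A)"

definition surface_measure :: "(real^2) set \<Rightarrow> (real^2) measure" where
  "surface_measure \<Omega> = restrict_space hausdorff_measure_1 (frontier \<Omega>)"


subsection \<open>Operators between \<open>L\<^sup>2\<close> spaces\<close>

definition L2 :: "'a measure \<Rightarrow> ('a \<Rightarrow> real) set" where
  "L2 M = {f \<in> borel_measurable M. integrable M (\<lambda>x. (f x)\<^sup>2)}"

text \<open>
  \<open>K\<close> acts on representatives; on \<open>L2 M\<close> it respects equality almost everywhere and is linear
  up to equality almost everywhere, so that it induces a linear map of the quotient spaces.
  Its values outside \<open>L2 M\<close> are left free.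
\<close>
definition L2_linear_operator ::
  "'a measure \<Rightarrow> 'b measure \<Rightarrow> (('a \<Rightarrow> real) \<Rightarrow> ('b \<Rightarrow> real)) \<Rightarrow> bool" where
  "L2_linear_operator M N K \<longleftrightarrow>
     (\<forall>f\<in>L2 M. K f \<in> L2 N) \<and>
     (\<forall>f\<in>L2 M. \<forall>g\<in>L2 M. (AE x in M. f x = g x) \<longrightarrow> (AE z in N. K f z = K g z)) \<and>
     (\<forall>f\<in>L2 M. \<forall>g\<in>L2 M. AE z in N. K (\<lambda>x. f x + g x) z = K f z + K g z) \<and>
     (\<forall>f\<in>L2 M. \<forall>c. AE z in N. K (\<lambda>x. c * f x) z = c * K f z)"


subsection \<open>Functions of bounded variation\<close>

definition grad :: "(real^'n::finite \<Rightarrow> real) \<Rightarrow> real^'n \<Rightarrow> real^'n" where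
  "grad f x = (\<chi> i. frechet_derivative f (at x) (axis i 1))"

definition C1_on :: "(real^'n::finite) set \<Rightarrow> (real^'n \<Rightarrow> real) \<Rightarrow> bool" where
  "C1_on S f \<longleftrightarrow> (\<forall>x\<in>S. f differentiable (at x)) \<and> continuous_on S (grad f)"

definition divergence :: "(real^'n::finite \<Rightarrow> real^'n) \<Rightarrow> real^'n \<Rightarrow> real" where
  "divergence \<phi> x = (\<Sum>i\<in>UNIV. grad (\<lambda>y. \<phi> y $ i) x $ i)"

definition C1c_fields :: "(real^'n::finite) set \<Rightarrow> (real^'n \<Rightarrow> real^'n) set" where
  "C1c_fields \<Omega> = {\<phi>. (\<forall>i. C1_on UNIV (\<lambda>y. \<phi> y $ i)) \<and>
      compact (closure {x. \<phi> x \<noteq> 0}) \<and> closure {x. \<phi> x \<noteq> 0} \<subseteq> \<Omega>}"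

text \<open>In the following, only \<open>space M\<close> and \<open>sets M\<close> matter, not the measure carried by \<open>M\<close>.\<close>

definition vector_measure :: "'a measure \<Rightarrow> ('a set \<Rightarrow> 'b::real_normed_vector) \<Rightarrow> bool" where
  "vector_measure M D \<longleftrightarrow> D {} = 0 \<and>
     (\<forall>A. range A \<subseteq> sets M \<and> disjoint_family A \<longrightarrow>
        (\<lambda>i::nat. D (A i)) sums D (\<Union>i. A i))"

definition total_variation :: "'a measure \<Rightarrow> ('a set \<Rightarrow> 'b::real_normed_vector) \<Rightarrow> 'a measure" where
  "total_variation M D = measure_of (space M) (sets M)
     (\<lambda>E. SUP A\<in>{A :: nat \<Rightarrow> 'a set. range A \<subseteq> sets M \<and> disjoint_family A \<and> (\<Union>i. A i) = E}.
            \<Sum>i. ennreal (norm (D (A i))))"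

definition polar_decomposition ::
  "'a measure \<Rightarrow> ('a set \<Rightarrow> real^'n::finite) \<Rightarrow> ('a \<Rightarrow> real^'n) \<Rightarrow> bool" where
  "polar_decomposition M D \<nu> \<longleftrightarrow>
     \<nu> \<in> borel_measurable M \<and>
     (AE y in total_variation M D. norm (\<nu> y) = 1) \<and>
     (\<forall>A\<in>sets M. D A = (LINT y:A|total_variation M D. \<nu> y))"

abbreviation borel_on :: "'a::topological_space set \<Rightarrow> 'a measure" where
  "borel_on \<Omega> \<equiv> restrict_space borel \<Omega>"

text \<open>
  \<open>D\<close> is a finite vector measure with \<open>\<integral> u div \<phi> dx = - \<integral> \<phi> \<bullet> dD\<close> for all \<open>C\<^sup>1\<close> fields \<open>\<phi>\<close> of compact
  support in \<open>\<Omega>\<close>; the integral against \<open>D = \<nu> |D|\<close> is \<open>\<integral> \<phi> \<bullet> \<nu> d|D|\<close>, which does not depend on the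
  choice of \<open>\<nu>\<close>.
\<close>
definition is_BV_derivative ::
  "(real^'n::finite) set \<Rightarrow> (real^'n \<Rightarrow> real) \<Rightarrow> ((real^'n) set \<Rightarrow> real^'n) \<Rightarrow> bool" where
  "is_BV_derivative \<Omega> u D \<longleftrightarrow>
     vector_measure (borel_on \<Omega>) D \<and>
     emeasure (total_variation (borel_on \<Omega>) D) \<Omega> < \<infinity> \<and>
     (\<exists>\<nu>. polar_decomposition (borel_on \<Omega>) D \<nu> \<and>
        (\<forall>\<phi>\<in>C1c_fields \<Omega>.
           (LINT x|lebesgue_on \<Omega>. u x * divergence \<phi> x) =
           - (LINT y|total_variation (borel_on \<Omega>) D. \<phi> y \<bullet> \<nu> y)))"

definition BV :: "(real^'n::finite) set \<Rightarrow> (real^'n \<Rightarrow> real) set" where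
  "BV \<Omega> = {u. integrable (lebesgue_on \<Omega>) u \<and> (\<exists>D. is_BV_derivative \<Omega> u D)}"

text \<open>The derivative is unique as a set function on the Borel subsets of \<open>\<Omega>\<close>.\<close>
definition BV_derivative ::
  "(real^'n::finite) set \<Rightarrow> (real^'n \<Rightarrow> real) \<Rightarrow> (real^'n) set \<Rightarrow> real^'n" where
  "BV_derivative \<Omega> u = (SOME D. is_BV_derivative \<Omega> u D)"

definition BV_variation :: "(real^'n::finite) set \<Rightarrow> (real^'n \<Rightarrow> real) \<Rightarrow> (real^'n) measure" where
  "BV_variation \<Omega> u = total_variation (borel_on \<Omega>) (BV_derivative \<Omega> u)"

definition is_polar_direction ::
  "(real^'n::finite) set \<Rightarrow> (real^'n \<Rightarrow> real) \<Rightarrow> (real^'n \<Rightarrow> real^'n) \<Rightarrow> bool" where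
  "is_polar_direction \<Omega> u \<nu> \<longleftrightarrow> polar_decomposition (borel_on \<Omega>) (BV_derivative \<Omega> u) \<nu>"


subsection \<open>Neumann Green's function and the weighted total variation\<close>

text \<open>
  \<open>G y x\<close> stands for \<open>G(y;x)\<close>. As \<open>\<partial>\<Omega>\<close> is only Lipschitz, the boundary value problem
  \<open>- \<Delta>\<^sub>y G(y;x) = \<delta>\<^sub>x(y) - 1/|\<Omega>|\<close> in \<open>\<Omega>\<close>, \<open>\<nabla>\<^sub>y G(y;x) \<bullet> n(y) = 0\<close> on \<open>\<partial>\<Omega>\<close> is understood weakly: test
  with a \<open>\<phi>\<close> that need not vanish on \<open>\<partial>\<Omega>\<close> and integrate by parts, the boundary term dropping out by
  the Neumann condition. Square integrability of the gradient away from the pole is the usual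
  energy condition; without it, reentrant corners would admit spurious singular solutions and
  uniqueness up to constants would fail. By interior regularity \<open>G\<close> has a representative that is
  \<open>C\<^sup>1\<close> off the pole, which is required here so that its gradient makes sense pointwise.
\<close>
definition neumann_green :: "(real^2) set \<Rightarrow> (real^2 \<Rightarrow> real^2 \<Rightarrow> real) \<Rightarrow> bool" where
  "neumann_green \<Omega> G \<longleftrightarrow>
     (\<forall>x\<in>\<Omega>. \<forall>y\<in>\<Omega>. G y x = G x y) \<and>
     (\<forall>x\<in>\<Omega>.
        C1_on (\<Omega> - {x}) (\<lambda>y. G y x) \<and>
        integrable (lebesgue_on \<Omega>) (\<lambda>y. G y x) \<and>
        integrable (lebesgue_on \<Omega>) (grad (\<lambda>y. G y x)) \<and>
        (\<forall>r>0. integrable (lebesgue_on (\<Omega> - ball x r)) (\<lambda>y. (norm (grad (\<lambda>y'. G y' x) y))\<^sup>2)) \<and>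
        (\<forall>\<phi>. C1_on UNIV \<phi> \<longrightarrow>
           (LINT y|lebesgue_on \<Omega>. grad (\<lambda>y'. G y' x) y \<bullet> grad \<phi> y) =
           \<phi> x - (LINT y|lebesgue_on \<Omega>. \<phi> y) / measure lebesgue \<Omega>))"

text \<open>
  \<open>K(\<nabla>G(\<cdot>;y) \<bullet> d)\<close>: the gradient is with respect to the second variable of \<open>G\<close>, and \<open>K\<close> acts on the
  first. In the plane \<open>\<nabla>G(\<cdot>;y) \<bullet> d\<close> has a \<open>1/|x - y|\<close> singularity and is not in \<open>L\<^sup>2(\<Omega>)\<close>, so this
  value of \<open>K\<close> is not governed by \<open>L2_linear_operator\<close>; see \<open>green_convention\<close>.
\<close>
definition K_grad_green ::
  "((real^2 \<Rightarrow> real) \<Rightarrow> (real^2 \<Rightarrow> real)) \<Rightarrow> (real^2 \<Rightarrow> real^2 \<Rightarrow> real) \<Rightarrow> real^2 \<Rightarrow> real^2 \<Rightarrow> real^2 \<Rightarrow> real"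
  where "K_grad_green K G y d = K (\<lambda>x. grad (\<lambda>y'. G x y') y \<bullet> d)"

text \<open>
  \<open>\<nu> f\<close> is the chosen direction field of \<open>Df\<close>. The last clause is the interchange of \<open>K\<close> with the
  integral in the representation formula for \<open>f\<close> (when \<open>K 1 = 0\<close>); existence of the integral is part
  of it, since the Bochner integral of a non-integrable function is 0 by convention.
\<close>
definition green_convention ::
  "(real^2) set \<Rightarrow> ((real^2 \<Rightarrow> real) \<Rightarrow> (real^2 \<Rightarrow> real)) \<Rightarrow> (real^2 \<Rightarrow> real^2 \<Rightarrow> real) \<Rightarrow>
   ((real^2 \<Rightarrow> real) \<Rightarrow> (real^2 \<Rightarrow> real^2)) \<Rightarrow> bool" where
  "green_convention \<Omega> K G \<nu> \<longleftrightarrow>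
     (\<forall>y\<in>\<Omega>. \<forall>z\<in>frontier \<Omega>. linear (\<lambda>d. K_grad_green K G y d z)) \<and>
     (\<forall>y\<in>\<Omega>. \<forall>d. integrable (surface_measure \<Omega>) (K_grad_green K G y d)) \<and>
     (\<forall>d. (\<lambda>(z, y). K_grad_green K G y d z)
             \<in> borel_measurable (borel_on (frontier \<Omega>) \<Otimes>\<^sub>M borel_on \<Omega>)) \<and>
     (\<forall>f\<in>BV \<Omega>. AE z in surface_measure \<Omega>.
        has_bochner_integral (BV_variation \<Omega> f) (\<lambda>y. K_grad_green K G y (\<nu> f y) z) (K f z))"

text \<open>The value may be infinite.\<close>
definition TV_weighted ::
  "(real^2) set \<Rightarrow> ((real^2 \<Rightarrow> real) \<Rightarrow> (real^2 \<Rightarrow> real)) \<Rightarrow> (real^2 \<Rightarrow> real^2 \<Rightarrow> real) \<Rightarrow>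
   ((real^2 \<Rightarrow> real) \<Rightarrow> (real^2 \<Rightarrow> real^2)) \<Rightarrow> (real^2 \<Rightarrow> real) \<Rightarrow> ennreal" where
  "TV_weighted \<Omega> K G \<nu> g =
     (\<integral>\<^sup>+y. (\<integral>\<^sup>+z. ennreal \<bar>K_grad_green K G y (\<nu> g y) z\<bar> \<partial>surface_measure \<Omega>) \<partial>BV_variation \<Omega> g)"

end

theory Submission
  imports Defs
begin

text \<open>
  Write \<open>k\<^sub>g(z,y)\<close> for the value at \<open>z\<close> of \<open>K(\<nabla>G(\<cdot>;y) \<bullet> \<nu>\<^sub>g(y))\<close>. The interchange of \<open>K\<close> with the integral
  says that \<open>Kg(z) = \<integral> k\<^sub>g(z,y) d|Dg|(y)\<close> for almost every \<open>z\<close>, so that the triangle inequality gives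
  \<open>|Kg(z)| \<le> \<integral> |k\<^sub>g(z,y)| d|Dg|(y)\<close>. Integrating over the boundary and exchanging the order of integration
  yields \<open>\<parallel>Kg\<parallel>\<^sub>1 \<le> TV(g)\<close>, a lower bound that depends on \<open>g\<close> only through \<open>Kg\<close> and hence takes the same
  value at all feasible \<open>g\<close>. The sign condition on \<open>f\<^sup>*\<close> excludes cancellation in the integral that
  represents \<open>Kf\<^sup>*(z)\<close>, so the triangle inequality is an equality for \<open>f\<^sup>*\<close> and \<open>f\<^sup>*\<close> attains the bound.

  What remains is to justify the exchange of integrals. Tonelli's theorem asks for \<open>\<sigma>\<close>-finite
  measures and a jointly measurable integrand. The measure \<open>|Dg|\<close> is finite by definition of \<open>BV\<close>. The boundary of a bounded
  Lipschitz domain has finite length, since by compactness it is covered by finitely many Lipschitz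
  graphs over bounded intervals. The integrand is jointly measurable although the direction \<open>\<nu>\<^sub>g(y)\<close>
  varies with \<open>y\<close>: by linearity in the direction it is a finite combination of kernels with fixed
  directions.
\<close>

section \<open>Finite length of a Lipschitz boundary\<close>

text \<open>
  Cutting the interval into \<open>N\<close> equal parts covers the curve by \<open>N\<close> sets of diameter at most
  \<open>C (b - a) / N\<close>. These bounds add up to \<open>C (b - a)\<close> for every \<open>N\<close>, so the mesh can be refined below
  any \<open>\<delta>\<close> without affecting the total.
\<close>
lemma hausdorff_content_lipschitz_image_le:
  fixes f :: "real \<Rightarrow> 'a::metric_space"
  assumes f: "C-lipschitz_on {a..b} f" and "a \<le> b" and "0 < \<delta>" and A: "A \<subseteq> f ` {a..b}"
  shows "hausdorff_content \<delta> A \<le> ennreal (C * (b - a))"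
proof -
  have C: "0 \<le> C"
    using f by (rule lipschitz_on_nonneg)
  obtain N :: nat where N: "C * (b - a) / \<delta> < real N"
    using reals_Archimedean2 by blast
  have "0 \<le> C * (b - a) / \<delta>"
    using C \<open>a \<le> b\<close> \<open>0 < \<delta>\<close> by simp
  with N have "0 < N"
    by linarith
  define s where "s = (b - a) / N"
  have s: "0 \<le> s" "N * s = b - a" "C * s \<le> \<delta>"
    using N \<open>0 < N\<close> \<open>a \<le> b\<close> \<open>0 < \<delta>\<close> by (auto simp: s_def field_simps)
  \<comment> \<open>Empty sets of diameter 0 extend the finite cover to a sequence.\<close>
  define P where "P i = (if i < N then f ` ({a..b} \<inter> {a + i * s..a + (i + 1) * s}) else {})"
    for i :: nat
  have dist_P: "dist x y \<le> C * s" if xy: "x \<in> P i" "y \<in> P i" for i x y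
  proof -
    obtain u v where uv: "x = f u" "y = f v" "u \<in> {a..b}" "v \<in> {a..b}"
        "u \<in> {a + i * s..a + (i + 1) * s}" "v \<in> {a + i * s..a + (i + 1) * s}"
      using xy by (auto simp: P_def split: if_splits)
    have "dist u v \<le> s"
      using uv(5,6) by (auto simp: dist_real_def abs_le_iff algebra_simps)
    then show ?thesis
      using lipschitz_onD[OF f uv(3,4)] C mult_left_mono[of "dist u v" s C] uv(1,2) by force
  qed
  have bounded_P: "bounded (P i)" for i
    using dist_P unfolding bounded_two_points by blast
  have diam_P: "diameter (P i) \<le> C * s" for i
  proof (cases "P i = {}")
    case False
    then show ?thesis
      using dist_P by (auto simp: diameter_def intro!: cSUP_least)
  qed (use C s in simp)
  have cover: "A \<subseteq> (\<Union>i. P i)"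
  proof
    fix x assume "x \<in> A"
    then obtain t where t: "x = f t" "t \<in> {a..b}"
      using A by auto
    \<comment> \<open>The first part whose right end is not left of \<open>t\<close>; unlike the integer part of \<open>(t - a) / s\<close>,
      this choice covers \<open>t = b\<close> and \<open>s = 0\<close>.\<close>
    define i where "i = (LEAST j. t \<le> a + (real j + 1) * s)"
    have last: "t \<le> a + (real (N - 1) + 1) * s"
      using t(2) s(2) \<open>0 < N\<close> by simp
    then have "i \<le> N - 1" and upper: "t \<le> a + (real i + 1) * s"
      unfolding i_def by (rule Least_le, use last in \<open>rule LeastI\<close>)
    have lower: "a + real i * s \<le> t"
    proof (cases i)
      case (Suc j)
      then have "\<not> t \<le> a + (real j + 1) * s"
        using not_less_Least[of j "\<lambda>j. t \<le> a + (real j + 1) * s"] by (simp add: i_def)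
      then show ?thesis
        using Suc by (simp add: algebra_simps)
    qed (use t(2) in simp)
    have "x \<in> P i"
      using t upper lower \<open>i \<le> N - 1\<close> \<open>0 < N\<close> by (auto simp: P_def algebra_simps intro!: image_eqI)
    then show "x \<in> (\<Union>i. P i)"
      by blast
  qed
  have "hausdorff_content \<delta> A \<le> (\<Sum>i. ennreal (diameter (P i)))"
    unfolding hausdorff_content_def
    using cover bounded_P diam_P s(3) by (intro INF_lower) (auto intro: order_trans)
  also have "\<dots> = (\<Sum>i<N. ennreal (diameter (P i)))"
    by (rule suminf_finite) (auto simp: P_def)
  also have "\<dots> \<le> (\<Sum>i<N. ennreal (C * s))"
    by (intro sum_mono ennreal_leI diam_P)
  also have "\<dots> = ennreal (C * (b - a))"
    using s by (simp add: ennreal_of_nat_eq_real_of_nat flip: ennreal_mult')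
      (metis mult.left_commute)
  finally show ?thesis .
qed

lemma sets_hausdorff_measure_1 [simp]:
  "sets (hausdorff_measure_1 :: 'a::metric_space measure) = sets borel"
proof -
  have "sigma_sets UNIV (sets borel) = sets (borel :: 'a measure)"
    by (metis sets.sigma_sets_eq space_borel)
  then show ?thesis
    by (simp add: hausdorff_measure_1_def)
qed

lemma space_hausdorff_measure_1 [simp]: "space hausdorff_measure_1 = UNIV"
  by (simp add: hausdorff_measure_1_def space_measure_of_conv)

text \<open>
  The outer measure is an upper bound in every case, because \<open>measure_of\<close> assigns to each set either
  its prescribed value or 0; and the contents of the curve are bounded uniformly in \<open>\<delta>\<close>.
\<close>
lemma emeasure_hausdorff_measure_1_lipschitz_image_finite:
  fixes f :: "real \<Rightarrow> 'a::metric_space"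
  assumes "C-lipschitz_on {a..b} f" and "a \<le> b" and "A \<subseteq> f ` {a..b}"
  shows "emeasure hausdorff_measure_1 A < \<infinity>"
proof -
  have "emeasure hausdorff_measure_1 A \<le> (SUP \<delta>\<in>{0<..}. hausdorff_content \<delta> A)"
    by (simp add: hausdorff_measure_1_def emeasure_measure_of_conv)
  also have "\<dots> \<le> ennreal (C * (b - a))"
    using assms by (intro SUP_least hausdorff_content_lipschitz_image_le) auto
  also have "\<dots> < \<infinity>"
    by simp
  finally show ?thesis .
qed

text \<open>
  In the chart at \<open>p\<close> the domain is the strict epigraph of a continuous \<open>\<gamma>\<close>, so points strictly below
  the graph are exterior and points strictly above it are interior; only the graph itself is left for
  the frontier, and \<open>t \<mapsto> (t, \<gamma> t)\<close> is Lipschitz.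
\<close>
lemma lipschitz_domain_frontier_locally_lipschitz_curve:
  assumes \<Omega>: "lipschitz_domain \<Omega>" and p: "p \<in> frontier \<Omega>"
  obtains U C r f where "open U" "p \<in> U" "0 \<le> r" "C-lipschitz_on {-r..r} f"
    "frontier \<Omega> \<inter> U \<subseteq> f ` {-r..r::real}"
proof -
  obtain T \<gamma> L r h where T: "orthogonal_transformation (T :: real^2 \<Rightarrow> real^2)"
      and \<gamma>: "L-lipschitz_on UNIV \<gamma>" and rh: "0 < r" "0 < h"
      and chart: "\<And>x. \<bar>T (x - p) $ 1\<bar> < r \<Longrightarrow> \<bar>T (x - p) $ 2\<bar> < h \<Longrightarrow>
        x \<in> \<Omega> \<longleftrightarrow> \<gamma> (T (x - p) $ 1) < T (x - p) $ 2"
    using \<Omega> p unfolding lipschitz_domain_def by metis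
  have "open \<Omega>"
    using \<Omega> by (simp add: lipschitz_domain_def)
  define S where "S = inv T"
  have S: "orthogonal_transformation S"
    using T by (simp add: S_def orthogonal_transformation_inv)
  have ST: "S (T x) = x" for x
    using T by (simp add: S_def orthogonal_transformation_inj)
  have contT: "continuous_on A (\<lambda>x. T (x - p) $ i)" for A i
  proof -
    have "bounded_linear T"
      using orthogonal_transformation_linear[OF T] by (simp add: linear_conv_bounded_linear)
    then have "continuous_on A (\<lambda>x. T (x - p))"
      by (rule bounded_linear.continuous_on) (simp add: continuous_on_diff)
    then show ?thesis
      by (rule continuous_on_component)
  qed
  have cont\<gamma>: "continuous_on A (\<lambda>x. \<gamma> (T (x - p) $ 1))" for A
    using lipschitz_on_continuous_on[OF \<gamma>] contT
    by (rule continuous_on_compose2) auto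
  define U where "U = {x. \<bar>T (x - p) $ 1\<bar> < r \<and> \<bar>T (x - p) $ 2\<bar> < h}"
  define f where "f t = p + S (vector [t, \<gamma> t])" for t
  show thesis
  proof
    show "open U"
      unfolding U_def
      by (intro open_Collect_conj open_Collect_less continuous_on_rabs continuous_on_const contT)
    show "p \<in> U"
      using rh linear_0[OF orthogonal_transformation_linear[OF T]] by (simp add: U_def)
    show "0 \<le> r"
      using rh by simp
    show "(1 + L)-lipschitz_on {-r..r} f"
    proof (rule lipschitz_onI)
      fix s t :: real
      have "dist (f s) (f t) = norm (S (vector [s, \<gamma> s] - vector [t, \<gamma> t]))"
        using linear_diff[OF orthogonal_transformation_linear[OF S]]
        by (simp add: f_def dist_norm)
      also have "\<dots> = norm (vector [s, \<gamma> s] - vector [t, \<gamma> t] :: real^2)"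
        by (rule orthogonal_transformation_norm[OF S])
      also have "\<dots> \<le> \<bar>s - t\<bar> + \<bar>\<gamma> s - \<gamma> t\<bar>"
        using norm_le_l1_cart[of "vector [s, \<gamma> s] - vector [t, \<gamma> t] :: real^2"]
        by (simp add: sum_2 vector_2)
      also have "\<dots> \<le> (1 + L) * dist s t"
        using lipschitz_onD[OF \<gamma>, of s t] by (simp add: dist_real_def algebra_simps)
      finally show "dist (f s) (f t) \<le> (1 + L) * dist s t" .
    qed (use lipschitz_on_nonneg[OF \<gamma>] in simp)
    show "frontier \<Omega> \<inter> U \<subseteq> f ` {-r..r}"
    proof
      fix x assume x: "x \<in> frontier \<Omega> \<inter> U"
      then have xU: "\<bar>T (x - p) $ 1\<bar> < r" "\<bar>T (x - p) $ 2\<bar> < h"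
        by (auto simp: U_def)
      have "x \<notin> \<Omega>"
        using x \<open>open \<Omega>\<close> by (simp add: frontier_def interior_open)
      then have ge: "T (x - p) $ 2 \<le> \<gamma> (T (x - p) $ 1)"
        using chart[OF xU] by simp
      have "\<not> T (x - p) $ 2 < \<gamma> (T (x - p) $ 1)"
      proof
        define V where "V = U \<inter> {y. T (y - p) $ 2 < \<gamma> (T (y - p) $ 1)}"
        assume "T (x - p) $ 2 < \<gamma> (T (x - p) $ 1)"
        then have "x \<in> V"
          using x by (simp add: V_def)
        moreover have "open V"
          unfolding V_def using \<open>open U\<close>
          by (intro open_Int open_Collect_less contT cont\<gamma>)
        moreover have "V \<inter> \<Omega> = {}"
          using chart by (force simp: V_def U_def)
        ultimately have "x \<notin> closure \<Omega>"
          using open_Int_closure_eq_empty by blast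
        then show False
          using x by (simp add: frontier_def)
      qed
      with ge have eq: "T (x - p) $ 2 = \<gamma> (T (x - p) $ 1)"
        by simp
      have "vector [T (x - p) $ 1, \<gamma> (T (x - p) $ 1)] = T (x - p)"
        using eq by (simp add: vec_eq_iff forall_2 vector_2)
      then have "x = f (T (x - p) $ 1)"
        by (simp add: f_def ST)
      then show "x \<in> f ` {-r..r}"
        using xU by (intro image_eqI[of _ _ "T (x - p) $ 1"]) auto
    qed
  qed
qed

lemma emeasure_hausdorff_measure_1_frontier_finite:
  assumes "bounded \<Omega>" and "lipschitz_domain \<Omega>"
  shows "emeasure hausdorff_measure_1 (frontier \<Omega>) < \<infinity>"
proof -
  let ?H = "hausdorff_measure_1 :: (real^2) measure"
  have "\<exists>U. open U \<and> p \<in> U \<and> emeasure ?H (frontier \<Omega> \<inter> U) < \<infinity>"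
    if p: "p \<in> frontier \<Omega>" for p
  proof -
    obtain U C r f where "open U" "p \<in> U" "0 \<le> r" "C-lipschitz_on {-r..r} f"
        "frontier \<Omega> \<inter> U \<subseteq> f ` {-r..r::real}"
      using lipschitz_domain_frontier_locally_lipschitz_curve[OF assms(2) p] .
    moreover from this have "emeasure ?H (frontier \<Omega> \<inter> U) < \<infinity>"
      by (intro emeasure_hausdorff_measure_1_lipschitz_image_finite[where f = f]) auto
    ultimately show ?thesis
      by blast
  qed
  then obtain U where U: "\<And>p. p \<in> frontier \<Omega> \<Longrightarrow>
      open (U p) \<and> p \<in> U p \<and> emeasure ?H (frontier \<Omega> \<inter> U p) < \<infinity>"
    by metis
  have "compact (frontier \<Omega>)"
    using assms(1) by (rule compact_frontier_bounded)
  then obtain F where F: "F \<subseteq> frontier \<Omega>" "finite F" "frontier \<Omega> \<subseteq> (\<Union>p\<in>F. U p)"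
    by (rule compactE_image[where f = U and C = "frontier \<Omega>"]) (use U in blast)+
  then have "frontier \<Omega> = (\<Union>p\<in>F. frontier \<Omega> \<inter> U p)"
    by auto
  then have "emeasure ?H (frontier \<Omega>) = emeasure ?H (\<Union>p\<in>F. frontier \<Omega> \<inter> U p)"
    by simp
  also have "\<dots> \<le> (\<Sum>p\<in>F. emeasure ?H (frontier \<Omega> \<inter> U p))"
    using F U by (intro emeasure_subadditive_finite) (auto intro!: sets.Int)
  also have "\<dots> < \<infinity>"
    using F U by (auto simp: less_top[symmetric])
  finally show ?thesis .
qed

lemma sets_surface_measure:
  "sets (surface_measure \<Omega>) = sets (borel_on (frontier \<Omega>))"
  unfolding surface_measure_def by (rule sets_restrict_space_cong) simp

lemma space_surface_measure: "space (surface_measure \<Omega>) = frontier \<Omega>"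
  by (simp add: surface_measure_def space_restrict_space)

lemma finite_measure_surface_measure:
  assumes "bounded \<Omega>" and "lipschitz_domain \<Omega>"
  shows "finite_measure (surface_measure \<Omega>)"
proof
  have "emeasure (surface_measure \<Omega>) (frontier \<Omega>) = emeasure hausdorff_measure_1 (frontier \<Omega>)"
    unfolding surface_measure_def by (rule emeasure_restrict_space) auto
  then show "emeasure (surface_measure \<Omega>) (space (surface_measure \<Omega>)) \<noteq> \<infinity>"
    using emeasure_hausdorff_measure_1_frontier_finite[OF assms]
    by (simp add: space_surface_measure)
qed

section \<open>Joint measurability and the exchange of integrals\<close>

lemma space_BV_variation: "space (BV_variation \<Omega> u) = \<Omega>"
  by (simp add: BV_variation_def total_variation_def space_measure_of_conv space_restrict_space)

lemma sets_BV_variation: "sets (BV_variation \<Omega> u) = sets (borel_on \<Omega>)"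
  unfolding BV_variation_def total_variation_def
  by (simp add: sets_measure_of_conv sets.space_closed sets.sigma_sets_eq)

lemma finite_measure_BV_variation:
  assumes "u \<in> BV \<Omega>"
  shows "finite_measure (BV_variation \<Omega> u)"
proof
  have "is_BV_derivative \<Omega> u (BV_derivative \<Omega> u)"
    using assms someI_ex[of "is_BV_derivative \<Omega> u"] by (simp add: BV_def BV_derivative_def)
  then have "emeasure (BV_variation \<Omega> u) \<Omega> < \<infinity>"
    by (simp add: is_BV_derivative_def BV_variation_def)
  then show "emeasure (BV_variation \<Omega> u) (space (BV_variation \<Omega> u)) \<noteq> \<infinity>"
    by (simp add: space_BV_variation)
qed

text \<open>
  Measurability for each fixed direction would not in general survive the substitution of a
  direction that depends on \<open>y\<close>. Linearity saves it: expanding \<open>v y\<close> in the standard basis leaves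
  finitely many fixed directions with measurable coefficients.
\<close>
lemma borel_measurable_direction_pairing:
  fixes k :: "'a \<Rightarrow> 'b \<Rightarrow> real^'n::finite \<Rightarrow> real"
  assumes lin: "\<And>z y. z \<in> space M \<Longrightarrow> y \<in> space N \<Longrightarrow> linear (k z y)"
    and meas: "\<And>d. (\<lambda>(z, y). k z y d) \<in> borel_measurable (M \<Otimes>\<^sub>M N)"
    and v: "v \<in> borel_measurable N"
  shows "(\<lambda>(z, y). k z y (v y)) \<in> borel_measurable (M \<Otimes>\<^sub>M N)"
proof -
  have "k z y (v y) = (\<Sum>i\<in>UNIV. v y $ i * k z y (axis i 1))"
    if "z \<in> space M" "y \<in> space N" for z y
  proof -
    have "k z y (v y) = k z y (\<Sum>i\<in>UNIV. (v y $ i) *\<^sub>R axis i 1)"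
      by (metis (mono_tags) basis_expansion scalar_mult_eq_scaleR)
    also have "\<dots> = (\<Sum>i\<in>UNIV. v y $ i * k z y (axis i 1))"
      using lin[OF that] by (simp add: linear_sum linear_cmul)
    finally show ?thesis .
  qed
  moreover have "(\<lambda>(z, y). \<Sum>i\<in>UNIV. v y $ i * k z y (axis i 1)) \<in> borel_measurable (M \<Otimes>\<^sub>M N)"
  proof -
    have "(\<lambda>x. v (snd x) $ i) \<in> borel_measurable (M \<Otimes>\<^sub>M N)" for i
      using measurable_compose[OF measurable_compose[OF measurable_snd v] borel_measurable_nth] .
    then show ?thesis
      using meas unfolding split_beta'
      by (intro borel_measurable_sum borel_measurable_times)
  qed
  ultimately show ?thesis
    by (subst measurable_cong) (auto simp: space_pair_measure)
qed

text \<open>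
  The weighted total variation integrates over the boundary first, whereas the representation of
  \<open>K g\<close> at a boundary point integrates over the domain first; this form makes the two comparable
  pointwise in \<open>z\<close>.
\<close>
lemma TV_weighted_eq_boundary_integral:
  assumes "bounded \<Omega>" and "lipschitz_domain \<Omega>" and "green_convention \<Omega> K G \<nu>"
    and "g \<in> BV \<Omega>" and "is_polar_direction \<Omega> g (\<nu> g)"
  shows "TV_weighted \<Omega> K G \<nu> g =
    (\<integral>\<^sup>+z. (\<integral>\<^sup>+y. ennreal \<bar>K_grad_green K G y (\<nu> g y) z\<bar> \<partial>BV_variation \<Omega> g) \<partial>surface_measure \<Omega>)"
proof -
  let ?S = "surface_measure \<Omega>" and ?V = "BV_variation \<Omega> g"
  interpret S: finite_measure ?S
    using assms(1,2) by (rule finite_measure_surface_measure)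
  interpret V: finite_measure ?V
    using assms(4) by (rule finite_measure_BV_variation)
  interpret pair_sigma_finite ?S ?V ..
  have "sets (?S \<Otimes>\<^sub>M ?V) = sets (borel_on (frontier \<Omega>) \<Otimes>\<^sub>M borel_on \<Omega>)"
    by (intro sets_pair_measure_cong sets_surface_measure sets_BV_variation)
  then have meas: "(\<lambda>(z, y). K_grad_green K G y d z) \<in> borel_measurable (?S \<Otimes>\<^sub>M ?V)" for d
    using assms(3) by (simp add: green_convention_def cong: measurable_cong_sets)
  have "\<nu> g \<in> borel_measurable ?V"
    using assms(5) unfolding is_polar_direction_def polar_decomposition_def
    by (simp add: measurable_cong_sets[OF sets_BV_variation refl])
  then have "(\<lambda>(z, y). K_grad_green K G y (\<nu> g y) z) \<in> borel_measurable (?S \<Otimes>\<^sub>M ?V)"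
    using assms(3)
    by (intro borel_measurable_direction_pairing
          [where k = "\<lambda>z y d. K_grad_green K G y d z", OF _ meas])
      (simp_all add: green_convention_def space_surface_measure space_BV_variation)
  then have "(\<lambda>(z, y). ennreal \<bar>K_grad_green K G y (\<nu> g y) z\<bar>) \<in> borel_measurable (?S \<Otimes>\<^sub>M ?V)"
    by (simp add: split_beta')
  from Fubini'[OF this] show ?thesis
    by (simp add: TV_weighted_def)
qed

section \<open>The triangle inequality and its equality case\<close>

lemma abs_integral_le_nn_integral:
  fixes f :: "'a \<Rightarrow> real"
  assumes "has_bochner_integral M f I"
  shows "ennreal \<bar>I\<bar> \<le> (\<integral>\<^sup>+y. ennreal \<bar>f y\<bar> \<partial>M)"
  using integral_norm_bound_ennreal[of M f] assms
  by (auto simp: has_bochner_integral_iff)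

lemma abs_integral_eq_nn_integral_of_constant_sign:
  fixes f :: "'a \<Rightarrow> real"
  assumes f: "has_bochner_integral M f I"
    and sign: "(\<forall>y\<in>space M. 0 \<le> f y) \<or> (\<forall>y\<in>space M. f y \<le> 0)"
  shows "(\<integral>\<^sup>+y. ennreal \<bar>f y\<bar> \<partial>M) = ennreal \<bar>I\<bar>"
proof -
  have *: "(\<integral>\<^sup>+y. ennreal \<bar>f y\<bar> \<partial>M) = ennreal \<bar>I\<bar>"
    if "has_bochner_integral M f I" "\<forall>y\<in>space M. 0 \<le> f y" for f :: "'a \<Rightarrow> real" and I
  proof -
    have "(\<integral>\<^sup>+y. ennreal \<bar>f y\<bar> \<partial>M) = (\<integral>\<^sup>+y. ennreal (f y) \<partial>M)"
      using that by (intro nn_integral_cong) auto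
    also have "\<dots> = ennreal I"
      using that by (subst nn_integral_eq_integral) (auto simp: has_bochner_integral_iff)
    also have "0 \<le> I"
      using that by (auto simp: has_bochner_integral_iff intro!: integral_nonneg_AE)
    then have "ennreal I = ennreal \<bar>I\<bar>"
      by simp
    finally show ?thesis .
  qed
  show ?thesis
    using sign *[OF f] *[OF has_bochner_integral_minus[OF f]] by auto
qed

section \<open>Optimality under the sign condition\<close>

theorem theorem4p1:
  fixes \<Omega> :: "(real^2) set"
    and K :: "(real^2 \<Rightarrow> real) \<Rightarrow> (real^2 \<Rightarrow> real)"
    and G :: "real^2 \<Rightarrow> real^2 \<Rightarrow> real"
    and \<nu> :: "(real^2 \<Rightarrow> real) \<Rightarrow> (real^2 \<Rightarrow> real^2)"
    and fstar :: "real^2 \<Rightarrow> real"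
  assumes "bounded \<Omega>" and "lipschitz_domain \<Omega>"
    and "L2_linear_operator (lebesgue_on \<Omega>) (surface_measure \<Omega>) K"
    and "neumann_green \<Omega> G"
    and "\<And>g. g \<in> BV \<Omega> \<Longrightarrow> is_polar_direction \<Omega> g (\<nu> g)"
    and "green_convention \<Omega> K G \<nu>"
    and "AE z in surface_measure \<Omega>. K (\<lambda>_. 1) z = 0"
    and "fstar \<in> BV \<Omega>"
    and "\<And>z. z \<in> frontier \<Omega> \<Longrightarrow>
           (\<forall>y\<in>\<Omega>. sgn (K_grad_green K G y (\<nu> fstar y) z) \<ge> 0) \<or>
           (\<forall>y\<in>\<Omega>. sgn (K_grad_green K G y (\<nu> fstar y) z) \<le> 0)"
  shows "is_arg_min (TV_weighted \<Omega> K G \<nu>)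
           (\<lambda>g. g \<in> BV \<Omega> \<and> (AE z in surface_measure \<Omega>. K g z = K fstar z)) fstar"
proof -
  have TV: "TV_weighted \<Omega> K G \<nu> g = (\<integral>\<^sup>+z. (\<integral>\<^sup>+y. ennreal \<bar>K_grad_green K G y (\<nu> g y) z\<bar>
      \<partial>BV_variation \<Omega> g) \<partial>surface_measure \<Omega>)" if "g \<in> BV \<Omega>" for g
    using assms(1,2,6) that assms(5)[OF that] by (rule TV_weighted_eq_boundary_integral)
  have repr: "AE z in surface_measure \<Omega>.
      has_bochner_integral (BV_variation \<Omega> g) (\<lambda>y. K_grad_green K G y (\<nu> g y) z) (K g z)"
    if "g \<in> BV \<Omega>" for g
    using assms(6) that by (simp add: green_convention_def)
  have "TV_weighted \<Omega> K G \<nu> fstar \<le> TV_weighted \<Omega> K G \<nu> g"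
    if g: "g \<in> BV \<Omega>" and feasible: "AE z in surface_measure \<Omega>. K g z = K fstar z" for g
    unfolding TV[OF g] TV[OF assms(8)]
  proof (rule nn_integral_mono_AE)
    show "AE z in surface_measure \<Omega>.
        (\<integral>\<^sup>+y. ennreal \<bar>K_grad_green K G y (\<nu> fstar y) z\<bar> \<partial>BV_variation \<Omega> fstar)
        \<le> (\<integral>\<^sup>+y. ennreal \<bar>K_grad_green K G y (\<nu> g y) z\<bar> \<partial>BV_variation \<Omega> g)"
      using repr[OF g] repr[OF assms(8)] feasible AE_space
    proof eventually_elim
      case (elim z)
      have "(\<integral>\<^sup>+y. ennreal \<bar>K_grad_green K G y (\<nu> fstar y) z\<bar> \<partial>BV_variation \<Omega> fstar)
          = ennreal \<bar>K fstar z\<bar>"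
        using elim(2) assms(9)[of z] elim(4)
        by (intro abs_integral_eq_nn_integral_of_constant_sign)
          (simp_all add: space_BV_variation space_surface_measure)
      also have "\<dots> \<le> (\<integral>\<^sup>+y. ennreal \<bar>K_grad_green K G y (\<nu> g y) z\<bar> \<partial>BV_variation \<Omega> g)"
        using abs_integral_le_nn_integral[OF elim(1)] elim(3) by simp
      finally show ?case .
    qed
  qed
  then show ?thesis
    using assms(8) by (auto simp: is_arg_min_def not_less)
qed

end
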